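(* Let $(\Omega,d,\mu)$ be a metric measure space, let $v\in\mathcal A_0$ be strictly increasing, and assume that $$h_\mu(r):=\inf_{x\in\Omega}\mu(B(x,r))\ge v(r),\qquad r>0 .$$ Let $0<p<\infty$ and set $p_0:=\min\{1,p\}$. Then the following hold. (i) There is a constant $C>0$ such that for every $f\in L^{p_0}(\mu)+L^\infty(\mu)$ and every $t>0$, $$O(|f|^{p_0},t)^{1/p_0}\le C\,\Big(\big(\big[\nabla^p_{v^{-1}(2t)}f\big]^p\big)^{**}(t)\Big)^{1/p}.$$ (ii) Let $\phi\in\mathcal A_0$ and set $\omega(t):=\phi(v^{-1}(t))$, $t>0$. There is a constant $C>0$ such that for every $f\in L^{p_0}(\mu)+L^\infty(\mu)$, every $g\in D^\phi(f)$ and every $t>0$, $$O(|f|^{p_0},t)^{1/p_0}\le C\,\omega(t)\,\big((g^p)^{**}(t)\big)^{1/p};$$ equivalently, $O(|f|^{p_0},t)\le C'\,\omega(t)^{p_0}\big((g^p)^{**}(t)\big)^{p_0/p}$ for a constant $C'>0$ independent of $f,g,t$.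
   Context: Metric measure space: $(\Omega,d)$ is a separable metric space, $\mu$ is a nonatomic Borel measure on $\Omega$ (in particular $\mu(\{x\})=0$ for all $x$) with $\mu(\Omega)=\infty$ and $0<\mu(B)<\infty$ for every open ball $B=B(x,r)=\{y:d(x,y)<r\}$. Rearrangements: for measurable $f$, $f^*(t)=\inf\{\lambda\ge0:\mu\{|f|>\lambda\}\le t\}$, $f^{**}(t)=\frac1t\int_0^tf^*(s)\,ds$, and the oscillation functional is $O(f,t)=f^{**}(t)-f^*(t)$, $t>0$. Averaged modulus: $\nabla_r^pf(x)=\Big(\frac1{\mu(B(x,r))}\int_{B(x,r)}|f(x)-f(y)|^p\,d\mu(y)\Big)^{1/p}$ (possibly $+\infty$). Haj\l asz gradients: $D^\phi(f)$ is the set of nonnegative measurable $g$ with $|f(x)-f(y)|\le\phi(d(x,y))(g(x)+g(y))$ for $\mu$-a.e. $x,y\in\Omega$. Class $\mathcal A_0$: continuous increasing functions $\phi:[0,\infty)\to[0,\infty)$ with $\phi(0)=0$, $\phi(t)>0$ for $t>0$, $M_\phi(\lambda):=\sup_{s>0}\phi(\lambda s)/\phi(s)<\infty$ for every $\lambda>0$, and $0<\underline\beta_\phi\le\overline\beta_\phi<\infty$, where $\underline\beta_\phi=\lim_{\lambda\to0^+}\frac{\log M_\phi(\lambda)}{\log\lambda}$ and $\overline\beta_\phi=\lim_{\lambda\to\infty}\frac{\log M_\phi(\lambda)}{\log\lambda}$. Functions in $\mathcal A_0$ are considered up to equivalence (two-sided bounds by constant multiples), and strictly increasing representatives are chosen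 whenever inverses are used. *)

theory Defs
  imports "HOL-Analysis.Analysis"
begin

text \<open>
  The space is the whole type. For metric spaces, separability is the same as the class
  \<^class>\<open>second_countable_topology\<close>.
\<close>

definition nonatomic :: "'a measure \<Rightarrow> bool" where
  "nonatomic M \<longleftrightarrow>
     (\<forall>A\<in>sets M. 0 < emeasure M A \<longrightarrow>
        (\<exists>B\<in>sets M. B \<subseteq> A \<and> 0 < emeasure M B \<and> emeasure M B < emeasure M A))"

definition metric_measure_space ::
    "'a::{metric_space, second_countable_topology} measure \<Rightarrow> bool" where
  "metric_measure_space M \<longleftrightarrow>
     sets M = sets borel \<and> nonatomic M \<and> emeasure M UNIV = \<infinity> \<and>
     (\<forall>x. \<forall>r>0. 0 < emeasure M (ball x r) \<and> emeasure M (ball x r) < \<infinity>)"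

definition h_mu :: "'a::metric_space measure \<Rightarrow> real \<Rightarrow> ennreal" where
  "h_mu M r = (INF x. emeasure M (ball x r))"

text \<open>Powers of extended nonnegative numbers; only used with exponents \<open>a > 0\<close>.\<close>

definition epowr :: "ennreal \<Rightarrow> real \<Rightarrow> ennreal" where
  "epowr x a = (if x = \<infinity> then \<infinity> else ennreal (enn2real x powr a))"

text \<open>
  Rearrangements are taken of \<open>F = \<bar>f\<bar>\<close>, which may take the value \<open>\<infinity>\<close>.
  Since \<open>c = \<infinity>\<close> is always admissible below, the infimum is \<open>\<infinity>\<close> exactly when
  no finite \<open>c\<close> is admissible.
\<close>

definition rearr :: "'a measure \<Rightarrow> ('a \<Rightarrow> ennreal) \<Rightarrow> real \<Rightarrow> ennreal" where
  "rearr M F t = Inf {c. emeasure M {x \<in> space M. c < F x} \<le> ennreal t}"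

definition rearr_avg :: "'a measure \<Rightarrow> ('a \<Rightarrow> ennreal) \<Rightarrow> real \<Rightarrow> ennreal" where
  "rearr_avg M F t = (\<integral>\<^sup>+ s\<in>{0<..<t}. rearr M F s \<partial>lborel) / ennreal t"

text \<open>
  Subtraction on \<^typ>\<open>ennreal\<close> truncates at \<open>0\<close> and satisfies \<open>\<infinity> - a = \<infinity>\<close>. The former is
  harmless because \<open>rearr M F\<close> is nonincreasing; the latter does not arise for
  \<open>F = \<bar>f\<bar> powr p0\<close> with \<open>f \<in> Lp_plus_Linf M p0\<close>, where both terms are finite.
\<close>

definition osc :: "'a measure \<Rightarrow> ('a \<Rightarrow> ennreal) \<Rightarrow> real \<Rightarrow> ennreal" where
  "osc M F t = rearr_avg M F t - rearr M F t"

definition Lp :: "'a measure \<Rightarrow> real \<Rightarrow> ('a \<Rightarrow> real) set" where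
  "Lp M p = {f \<in> borel_measurable M. integrable M (\<lambda>x. \<bar>f x\<bar> powr p)}"

definition Linf :: "'a measure \<Rightarrow> ('a \<Rightarrow> real) set" where
  "Linf M = {f \<in> borel_measurable M. \<exists>K. AE x in M. \<bar>f x\<bar> \<le> K}"

definition Lp_plus_Linf :: "'a measure \<Rightarrow> real \<Rightarrow> ('a \<Rightarrow> real) set" where
  "Lp_plus_Linf M p = {\<lambda>x. a x + b x | a b. a \<in> Lp M p \<and> b \<in> Linf M}"

definition avg_modulus ::
    "'a::metric_space measure \<Rightarrow> real \<Rightarrow> real \<Rightarrow> ('a \<Rightarrow> real) \<Rightarrow> 'a \<Rightarrow> ennreal" where
  "avg_modulus M p r f x =
     epowr ((\<integral>\<^sup>+ y\<in>ball x r. ennreal (\<bar>f x - f y\<bar> powr p) \<partial>M) / emeasure M (ball x r)) (1 / p)"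

text \<open>
  Gradients may take the value \<open>\<infinity>\<close>. The exceptional set is that of the iterated
  quantifier, the weakest reading of ``for almost every \<open>x, y\<close>''.
\<close>

definition hajlasz_gradients ::
    "'a::metric_space measure \<Rightarrow> (real \<Rightarrow> real) \<Rightarrow> ('a \<Rightarrow> real) \<Rightarrow> ('a \<Rightarrow> ennreal) set" where
  "hajlasz_gradients M \<phi> f =
     {g \<in> borel_measurable M.
        AE x in M. AE y in M. ennreal \<bar>f x - f y\<bar> \<le> ennreal (\<phi> (dist x y)) * (g x + g y)}"

text \<open>
  Functions on \<open>[0, \<infinity>)\<close> are represented by functions on \<^typ>\<open>real\<close> whose values at negative
  arguments are irrelevant.
\<close>

definition dilation :: "(real \<Rightarrow> real) \<Rightarrow> real \<Rightarrow> real" where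
  "dilation \<phi> c = (SUP s\<in>{0<..}. \<phi> (c * s) / \<phi> s)"

definition class_A0 :: "(real \<Rightarrow> real) set" where
  "class_A0 = {\<phi>.
     continuous_on {0..} \<phi> \<and> mono_on {0..} \<phi> \<and> \<phi> 0 = 0 \<and> (\<forall>t>0. 0 < \<phi> t) \<and>
     (\<forall>c>0. bdd_above ((\<lambda>s. \<phi> (c * s) / \<phi> s) ` {0<..})) \<and>
     (\<exists>\<beta>\<^sub>l \<beta>\<^sub>u. ((\<lambda>c. ln (dilation \<phi> c) / ln c) \<longlongrightarrow> \<beta>\<^sub>l) (at_right 0) \<and>
             ((\<lambda>c. ln (dilation \<phi> c) / ln c) \<longlongrightarrow> \<beta>\<^sub>u) at_top \<and>
             0 < \<beta>\<^sub>l \<and> \<beta>\<^sub>l \<le> \<beta>\<^sub>u)}"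

text \<open>
  For strictly increasing \<open>v \<in> class_A0\<close> the map \<open>v\<close> is a bijection of \<open>[0, \<infinity>)\<close>: a positive
  lower index forces \<open>v\<close> to be unbounded.
\<close>

definition inv0 :: "(real \<Rightarrow> real) \<Rightarrow> real \<Rightarrow> real" where
  "inv0 v = the_inv_into {0..} v"

end

theory Submission
  imports Defs
begin

text \<open>
  Let \<open>F = \<bar>f\<bar> powr p0\<close>, \<open>c = F\<^sup>*(t)\<close> and \<open>A = {F > c}\<close>, so that \<open>\<mu>(A) \<le> t\<close> and
  \<open>O(F, t) = (1/t) \<integral>\<^sub>A (F - c)\<close>. With \<open>r = v\<^sup>-\<^sup>1(2t)\<close> every ball \<open>B(x, r)\<close> has measure at least
  \<open>2t\<close>, hence at least half of it lies outside \<open>A\<close>, and there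
  \<open>F(x) - c \<le> F(x) - F(y) \<le> \<bar>f(x) - f(y)\<bar> powr p0\<close>. Averaging the power \<open>p/p0\<close> of this inequality
  over \<open>B(x, r)\<close> bounds \<open>F - c\<close> on \<open>A\<close> by \<open>(2 G) powr (p0/p)\<close>, where \<open>G\<close> is the \<open>p\<close>-th power of
  the averaged modulus, and Jensen's inequality gives
  \<open>O(F, t) \<le> ((2/t) \<integral>\<^sub>A G) powr (p0/p)\<close>. The first part follows since
  \<open>(1/t) \<integral>\<^sub>A G \<le> G\<^sup>*\<^sup>*(t)\<close>. For the second, \<open>G \<le> (2 \<phi>(r)) powr p (g powr p + (g powr p)\<^sup>*\<^sup>*(t))\<close>
  almost everywhere, because averages over sets of measure at least \<open>t\<close> are bounded by the
  maximal rearrangement at \<open>t\<close>; finally the positive lower index of \<open>v\<close> makes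
  \<open>v\<^sup>-\<^sup>1\<close>, and hence \<open>\<phi> \<circ> v\<^sup>-\<^sup>1\<close>, doubling.
\<close>

section \<open>Powers of extended nonnegative numbers\<close>

lemma epowr_ennreal: "0 \<le> x \<Longrightarrow> epowr (ennreal x) a = ennreal (x powr a)"
  by (simp add: epowr_def)

lemma epowr_top: "epowr top a = top"
  by (simp add: epowr_def)

lemma epowr_one: "epowr x 1 = x"
  by (cases x) (auto simp: epowr_def)

lemma epowr_mono:
  assumes "x \<le> y" "0 < a"
  shows "epowr x a \<le> epowr y a"
  using assms
  by (cases x; cases y) (auto simp: epowr_def top_unique intro!: ennreal_leI powr_mono2)

lemma epowr_mult:
  assumes "0 < a"
  shows "epowr (x * y) a = epowr x a * epowr y a"
proof (cases "x = 0 \<or> y = 0")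
  case True
  then show ?thesis by (auto simp: epowr_def)
next
  case False
  show ?thesis
  proof (cases "x = \<infinity> \<or> y = \<infinity>")
    case True
    with False show ?thesis
      by (cases x; cases y) (auto simp: epowr_def ennreal_mult_top ennreal_top_mult)
  next
    case fin: False
    then show ?thesis
      by (cases x; cases y)
        (auto simp: epowr_ennreal powr_mult simp flip: ennreal_mult)
  qed
qed

lemma epowr_ennreal_mult:
  "0 < a \<Longrightarrow> 0 \<le> c \<Longrightarrow> epowr (ennreal c * x) a = ennreal (c powr a) * epowr x a"
  by (simp add: epowr_mult epowr_ennreal)

lemma epowr_epowr: "epowr (epowr x a) b = epowr x (a * b)"
  by (cases x) (auto simp: epowr_ennreal epowr_top powr_powr)

lemma measurable_epowr [measurable]:
  assumes [measurable]: "f \<in> borel_measurable M"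
  shows "(\<lambda>x. epowr (f x) a) \<in> borel_measurable M"
  unfolding epowr_def by measurable

text \<open>A sum is at most twice the larger term, which gives one constant that serves exponents
  below and above 1 alike.\<close>

lemma epowr_add_le:
  assumes "0 < p"
  shows "epowr (x + y) p \<le> ennreal (2 powr p) * (epowr x p + epowr y p)"
proof -
  have "epowr (x + y) p \<le> epowr (ennreal 2 * max x y) p"
  proof (rule epowr_mono)
    have "x + y \<le> max x y + max x y" by (intro add_mono) auto
    then show "x + y \<le> ennreal 2 * max x y" by (simp add: mult_2)
  qed fact
  also have "\<dots> = ennreal (2 powr p) * epowr (max x y) p"
    using assms by (rule epowr_ennreal_mult) simp
  also have "epowr (max x y) p \<le> epowr x p + epowr y p"
    by (simp add: max_def add_increasing add_increasing2)
  finally show ?thesis by (simp add: mult_left_mono)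
qed

section \<open>Distribution functions, rearrangements and the layer cake formula\<close>

text \<open>The infimum defining \<open>rearr\<close> is attained: the sets \<open>{d n < F}\<close>
  increase to \<open>{c < F}\<close> as \<open>d n\<close> decreases to \<open>c\<close>, so the
  distribution function is right-continuous. This duality between levels and measures is how
  rearrangements are handled from here on.\<close>

lemma rearr_less_iff:
  assumes [measurable]: "F \<in> borel_measurable M"
  shows "c < rearr M F t \<longleftrightarrow> ennreal t < emeasure M {x \<in> space M. c < F x}"
proof -
  have "emeasure M {x \<in> space M. c < F x} \<le> ennreal t" if le: "rearr M F t \<le> c"
  proof (cases "c = \<infinity>")
    case True
    then show ?thesis by simp
  next
    case False
    define d where "d n = c + ennreal (1 / real (Suc n))" for n
    have "(\<lambda>n. c + ennreal (1 / real (Suc n))) \<longlonglongrightarrow> c + ennreal 0"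
      by (intro tendsto_intros) (use LIMSEQ_Suc[OF lim_1_over_n] in simp)
    then have lim: "d \<longlonglongrightarrow> c" by (simp add: d_def[abs_def])
    have gt: "c < d n" for n
      using False by (cases c) (auto simp: d_def ennreal_plus[symmetric] ennreal_less_iff simp del: ennreal_plus)
    have "antimono d"
      by (intro antimonoI) (auto simp: d_def intro!: add_left_mono ennreal_leI divide_left_mono)
    then have inc: "incseq (\<lambda>n. {x \<in> space M. d n < F x})"
      by (auto simp: incseq_def antimono_def intro: order.strict_trans1)
    have "{x \<in> space M. c < F x} = (\<Union>n. {x \<in> space M. d n < F x})"
    proof (intro equalityI subsetI)
      fix x assume x: "x \<in> {x \<in> space M. c < F x}"
      then have "\<forall>\<^sub>F n in sequentially. d n < F x"
        using lim by (auto intro: order_tendstoD)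
      then show "x \<in> (\<Union>n. {x \<in> space M. d n < F x})"
        using x by (auto simp: eventually_sequentially)
    qed (use gt in \<open>auto intro: less_trans\<close>)
    then have "emeasure M {x \<in> space M. c < F x} = (SUP n. emeasure M {x \<in> space M. d n < F x})"
      by (subst SUP_emeasure_incseq[OF _ inc]) auto
    also have "\<dots> \<le> ennreal t"
    proof (rule SUP_least)
      fix n
      have "rearr M F t < d n" using le gt[of n] by (rule le_less_trans)
      then obtain e where e: "emeasure M {x \<in> space M. e < F x} \<le> ennreal t" "e < d n"
        unfolding rearr_def by (auto simp: Inf_less_iff)
      have "emeasure M {x \<in> space M. d n < F x} \<le> emeasure M {x \<in> space M. e < F x}"
        using e by (intro emeasure_mono) auto
      with e show "emeasure M {x \<in> space M. d n < F x} \<le> ennreal t" by simp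
    qed
    finally show ?thesis .
  qed
  moreover have "rearr M F t \<le> c" if "emeasure M {x \<in> space M. c < F x} \<le> ennreal t"
    unfolding rearr_def using that by (auto intro: Inf_lower)
  ultimately show ?thesis by (meson not_le)
qed

lemma rearr_antimono:
  assumes "s \<le> t"
  shows "rearr M F t \<le> rearr M F s"
  unfolding rearr_def
  by (rule Inf_superset_mono) (use assms in \<open>auto intro: order_trans ennreal_leI\<close>)

lemma measurable_rearr [measurable]: "rearr M F \<in> borel_measurable borel"
proof (rule borel_measurableI_greater)
  fix y
  have "is_interval {s. y < rearr M F s}"
    using rearr_antimono by (fastforce simp: is_interval_1 intro: less_le_trans)
  then have "{s. y < rearr M F s} \<in> sets borel"
    by (rule real_interval_borel_measurable)
  then show "{x \<in> space borel. y < rearr M F x} \<in> sets borel" by simp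
qed

text \<open>Represents an extended number, possibly infinite, as a length. It prepares the layer
  cake formula and also computes distribution functions of rearrangements.\<close>

lemma emeasure_lborel_below:
  "emeasure lborel {s::real. 0 < s \<and> ennreal s < y} = y"
proof (cases y)
  case (real a)
  then have "{s::real. 0 < s \<and> ennreal s < y} = {0<..<a}"
    by (auto simp: ennreal_less_iff)
  then show ?thesis using real by simp
next
  case top
  have "ennreal a \<le> emeasure lborel {s::real. 0 < s \<and> ennreal s < y}" for a
  proof (cases "0 \<le> a")
    case True
    then have "ennreal a = emeasure lborel {0<..<a}" by simp
    also have "\<dots> \<le> emeasure lborel {s::real. 0 < s \<and> ennreal s < y}"
      using top by (intro emeasure_mono) auto
    finally show ?thesis .
  qed (simp add: ennreal_neg)
  then show ?thesis
    using top ennreal_Ex_less_of_nat by (metis ennreal_of_nat_eq_real_of_nat leD top.not_eq_extremum)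
qed

text \<open>Tonelli's theorem for the region below the graph of \<open>u\<close>, whose vertical
  sections have length \<open>u x\<close>; this is where sigma-finiteness enters.\<close>

lemma nn_integral_layer_cake:
  assumes "sigma_finite_measure M" and [measurable]: "u \<in> borel_measurable M"
  shows "(\<integral>\<^sup>+x. u x \<partial>M) =
         (\<integral>\<^sup>+s\<in>{0<..}. emeasure M {x \<in> space M. ennreal s < u x} \<partial>lborel)"
proof -
  interpret sigma_finite_measure M by fact
  interpret pair_sigma_finite M lborel ..
  let ?I = "\<lambda>x s::real. indicator {s. 0 < s \<and> ennreal s < u x} s :: ennreal"
  have "(\<integral>\<^sup>+x. u x \<partial>M) = (\<integral>\<^sup>+x. (\<integral>\<^sup>+s. ?I x s \<partial>lborel) \<partial>M)"
    by (simp add: emeasure_lborel_below)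
  also have "\<dots> = (\<integral>\<^sup>+s. (\<integral>\<^sup>+x. ?I x s \<partial>M) \<partial>lborel)"
    by (rule Fubini'[symmetric]) measurable
  also have "\<dots> = (\<integral>\<^sup>+s\<in>{0<..}. emeasure M {x \<in> space M. ennreal s < u x} \<partial>lborel)"
  proof (intro nn_integral_cong)
    fix s :: real
    have "(\<integral>\<^sup>+x. ?I x s \<partial>M)
        = (\<integral>\<^sup>+x. indicator {0<..} s * indicator {x \<in> space M. ennreal s < u x} x \<partial>M)"
      by (intro nn_integral_cong) (auto split: split_indicator)
    also have "\<dots> = emeasure M {x \<in> space M. ennreal s < u x} * indicator {0<..} s"
      by (simp add: nn_integral_cmult mult.commute)
    finally show "(\<integral>\<^sup>+x. ?I x s \<partial>M) = emeasure M {x \<in> space M. ennreal s < u x} * indicator {0<..} s" .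
  qed
  finally show ?thesis .
qed

text \<open>
  Both sides are computed by the layer cake formula; above the level \<open>rearr M F t\<close> the
  distribution functions of \<open>F\<close> and of its rearrangement coincide, and they are at most \<open>t\<close>.
\<close>

lemma nn_integral_rearr_eq:
  fixes F :: "'a \<Rightarrow> ennreal"
  assumes sf: "sigma_finite_measure M" and [measurable]: "F \<in> borel_measurable M"
    and t: "0 < t" and fin: "rearr M F t \<noteq> \<infinity>"
  shows "(\<integral>\<^sup>+s\<in>{0<..<t}. rearr M F s \<partial>lborel) =
         ennreal t * rearr M F t + (\<integral>\<^sup>+x. F x - rearr M F t \<partial>M)"
proof -
  define c where "c = rearr M F t"
  \<comment> \<open>Finiteness of the level \<open>c\<close> lets truncated subtraction be moved
    across the strict inequality.\<close>
  have diff: "ennreal s < z - c \<longleftrightarrow> c + ennreal s < z" for s z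
    using fin less_diff_eq_ennreal[of z c "ennreal s"]
    by (simp add: c_def top.not_eq_extremum add.commute)
  have tail: "emeasure M {x \<in> space M. c + ennreal s < F x} \<le> ennreal t" for s
  proof -
    have "\<not> c + ennreal s < rearr M F t" by (simp add: c_def not_less)
    then show ?thesis by (simp add: rearr_less_iff not_less)
  qed
  have "(\<integral>\<^sup>+x. F x - c \<partial>M)
      = (\<integral>\<^sup>+s\<in>{0<..}. emeasure M {x \<in> space M. c + ennreal s < F x} \<partial>lborel)"
    using nn_integral_layer_cake[OF sf, of "\<lambda>x. F x - c"] by (simp add: diff)
  also have "\<dots> = (\<integral>\<^sup>+s\<in>{0<..}. emeasure lborel {r \<in> space lborel.
        ennreal s < (rearr M F r - c) * indicator {0<..<t} r} \<partial>lborel)"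
  proof (intro nn_integral_cong arg_cong2[where f = "(*)"] refl)
    fix s :: real
    have "{r \<in> space lborel. ennreal s < (rearr M F r - c) * indicator {0<..<t} r}
        = {r. 0 < r \<and> ennreal r < emeasure M {x \<in> space M. c + ennreal s < F x}}" (is "?A = ?B")
    proof (intro equalityI subsetI)
      fix r assume "r \<in> ?A"
      then show "r \<in> ?B"
        by (auto simp: diff rearr_less_iff split: split_indicator_asm)
    next
      fix r assume r: "r \<in> ?B"
      \<comment> \<open>By \<open>tail\<close>, every \<open>r\<close> counted in \<open>?B\<close>
        lies below \<open>t\<close> anyway, so cutting the rearrangement off at \<open>t\<close>
        loses nothing.\<close>
      then have "ennreal r < ennreal t" using tail[of s] by (auto intro: less_le_trans)
      then have "r < t" using r by (auto simp: ennreal_less_iff)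
      with r show "r \<in> ?A" by (auto simp: diff rearr_less_iff)
    qed
    then show "emeasure M {x \<in> space M. c + ennreal s < F x} =
        emeasure lborel {r \<in> space lborel. ennreal s < (rearr M F r - c) * indicator {0<..<t} r}"
      by (simp add: emeasure_lborel_below)
  qed
  also have "\<dots> = (\<integral>\<^sup>+r\<in>{0<..<t}. rearr M F r - c \<partial>lborel)"
    by (rule nn_integral_layer_cake[symmetric]) (auto simp: lborel.sigma_finite_measure_axioms)
  finally have eq: "(\<integral>\<^sup>+x. F x - c \<partial>M) = (\<integral>\<^sup>+r\<in>{0<..<t}. rearr M F r - c \<partial>lborel)" .
  have "(\<integral>\<^sup>+s\<in>{0<..<t}. rearr M F s \<partial>lborel)
      = (\<integral>\<^sup>+r. c * indicator {0<..<t} r + (rearr M F r - c) * indicator {0<..<t} r \<partial>lborel)"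
    using rearr_antimono[of _ t M F]
    by (intro nn_integral_cong)
      (auto simp: c_def add_diff_inverse_ennreal less_imp_le split: split_indicator)
  also have "\<dots> = c * ennreal t + (\<integral>\<^sup>+r\<in>{0<..<t}. rearr M F r - c \<partial>lborel)"
    using t by (subst nn_integral_add) (auto simp: nn_integral_cmult)
  finally show ?thesis using eq by (simp add: c_def mult.commute)
qed

section \<open>Oscillation, averages and the maximal rearrangement\<close>

text \<open>The mean over \<open>(0, t)\<close> of a nonincreasing function dominates its value at
  \<open>t\<close>. In particular an infinite \<open>rearr M F t\<close> makes upper bounds by
  \<open>rearr_avg M F t\<close> trivial.\<close>

lemma rearr_le_rearr_avg:
  assumes "0 < t"
  shows "rearr M F t \<le> rearr_avg M F t"
proof -
  have "rearr M F t * ennreal t = (\<integral>\<^sup>+s\<in>{0<..<t}. rearr M F t \<partial>lborel)"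
    using assms by (simp add: nn_integral_cmult)
  also have "\<dots> \<le> (\<integral>\<^sup>+s\<in>{0<..<t}. rearr M F s \<partial>lborel)"
    by (intro nn_integral_mono) (auto split: split_indicator intro: rearr_antimono)
  finally have "rearr M F t * ennreal t / ennreal t \<le> rearr_avg M F t"
    unfolding rearr_avg_def by (rule divide_right_mono_ennreal)
  then show ?thesis using assms by (simp add: ennreal_mult_divide_eq)
qed

lemma rearr_avg_eq:
  assumes "sigma_finite_measure M" "F \<in> borel_measurable M"
    and "0 < t" "rearr M F t \<noteq> \<infinity>"
  shows "rearr_avg M F t = rearr M F t + (\<integral>\<^sup>+x. F x - rearr M F t \<partial>M) / ennreal t"
  using assms unfolding rearr_avg_def nn_integral_rearr_eq[OF assms]
  by (subst add_divide_distrib_ennreal)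
    (simp add: mult.commute[of "ennreal t"] ennreal_mult_divide_eq)

lemma osc_eq:
  assumes "sigma_finite_measure M" "F \<in> borel_measurable M"
    and "0 < t" "rearr M F t \<noteq> \<infinity>"
  shows "osc M F t = (\<integral>\<^sup>+x. F x - rearr M F t \<partial>M) / ennreal t"
  unfolding osc_def rearr_avg_eq[OF assms] using assms(4) by simp

text \<open>Splits \<open>F\<close> into the level, paid only on \<open>A\<close>, and the excess
  over it, paid everywhere. It feeds both bounds below, for sets of measure at most \<open>t\<close>
  and at least \<open>t\<close>.\<close>

lemma nn_integral_le_rearr:
  assumes [measurable]: "F \<in> borel_measurable M" "A \<in> sets M"
  shows "(\<integral>\<^sup>+x\<in>A. F x \<partial>M) \<le> rearr M F t * emeasure M A + (\<integral>\<^sup>+x. F x - rearr M F t \<partial>M)"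
proof -
  have "(\<integral>\<^sup>+x\<in>A. F x \<partial>M) \<le> (\<integral>\<^sup>+x. rearr M F t * indicator A x + (F x - rearr M F t) \<partial>M)"
  proof (intro nn_integral_mono)
    fix x
    have "F x \<le> rearr M F t + (F x - rearr M F t)"
      by (cases "rearr M F t \<le> F x") (simp_all add: add_diff_inverse_ennreal add_increasing2)
    then show "F x * indicator A x \<le> rearr M F t * indicator A x + (F x - rearr M F t)"
      by (auto split: split_indicator)
  qed
  also have "\<dots> = rearr M F t * emeasure M A + (\<integral>\<^sup>+x. F x - rearr M F t \<partial>M)"
    by (subst nn_integral_add) (auto simp: nn_integral_cmult)
  finally show ?thesis .
qed

lemma nn_integral_le_rearr_avg:
  assumes "sigma_finite_measure M" "F \<in> borel_measurable M" "A \<in> sets M"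
    and "0 < t" "emeasure M A \<le> ennreal t"
  shows "(\<integral>\<^sup>+x\<in>A. F x \<partial>M) / ennreal t \<le> rearr_avg M F t"
proof (cases "rearr M F t = \<infinity>")
  case True
  then show ?thesis using rearr_le_rearr_avg[OF assms(4), of M F] by (simp add: top_unique)
next
  case False
  have "(\<integral>\<^sup>+x\<in>A. F x \<partial>M) \<le> rearr M F t * emeasure M A + (\<integral>\<^sup>+x. F x - rearr M F t \<partial>M)"
    using assms False by (intro nn_integral_le_rearr)
  also have "\<dots> \<le> rearr M F t * ennreal t + (\<integral>\<^sup>+x. F x - rearr M F t \<partial>M)"
    using assms by (intro add_mono mult_left_mono) auto
  also have "\<dots> = (\<integral>\<^sup>+s\<in>{0<..<t}. rearr M F s \<partial>lborel)"
    using assms False by (simp add: nn_integral_rearr_eq mult.commute)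
  finally show ?thesis unfolding rearr_avg_def by (rule divide_right_mono_ennreal)
qed

lemma ennreal_divide_antimono:
  fixes a b c :: ennreal
  assumes "c \<le> b"
  shows "a / b \<le> a / c"
proof -
  have "inverse b \<le> inverse c"
    using assms by (simp add: inverse_ennreal.rep_eq ereal_inverse_antimono less_eq_ennreal.rep_eq)
  then show ?thesis by (simp add: divide_ennreal_def mult_left_mono)
qed

text \<open>After division by the measure of \<open>A\<close>, the level contributes exactly itself,
  and the excess contributes no more than it does when divided by the smaller number
  \<open>t\<close>.\<close>

lemma nn_average_le_rearr_avg:
  assumes "sigma_finite_measure M" "F \<in> borel_measurable M" "A \<in> sets M"
    and "0 < t" "ennreal t \<le> emeasure M A" "emeasure M A < \<infinity>"
  shows "(\<integral>\<^sup>+x\<in>A. F x \<partial>M) / emeasure M A \<le> rearr_avg M F t"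
proof (cases "rearr M F t = \<infinity>")
  case True
  then show ?thesis using rearr_le_rearr_avg[OF assms(4), of M F] by (simp add: top_unique)
next
  case False
  have pos: "emeasure M A \<noteq> 0" using assms(4,5) by (auto simp: ennreal_eq_0_iff)
  let ?I = "\<integral>\<^sup>+x. F x - rearr M F t \<partial>M"
  have "(\<integral>\<^sup>+x\<in>A. F x \<partial>M) / emeasure M A \<le> (rearr M F t * emeasure M A + ?I) / emeasure M A"
    using assms False by (intro divide_right_mono_ennreal nn_integral_le_rearr)
  also have "\<dots> = rearr M F t + ?I / emeasure M A"
    using pos assms(6) by (subst add_divide_distrib_ennreal) (simp add: ennreal_mult_divide_eq)
  also have "\<dots> \<le> rearr M F t + ?I / ennreal t"
    using assms by (intro add_left_mono) (auto intro: ennreal_divide_antimono)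
  also have "\<dots> = rearr_avg M F t"
    using assms False by (simp add: rearr_avg_eq)
  finally show ?thesis .
qed

section \<open>Concavity inequalities for powers\<close>

text \<open>Jensen's inequality for a concave power, normalised by \<open>t\<close> instead of the
  measure of \<open>A\<close>: the missing mass is harmless, as if \<open>h\<close> were extended by
  zero.\<close>

lemma nn_integral_epowr_le:
  assumes [measurable]: "h \<in> borel_measurable M" "A \<in> sets M"
    and t: "0 < t" "emeasure M A \<le> ennreal t" and q: "0 < q" "q \<le> 1"
  shows "(\<integral>\<^sup>+x\<in>A. epowr (h x) q \<partial>M) / ennreal t \<le> epowr ((\<integral>\<^sup>+x\<in>A. h x \<partial>M) / ennreal t) q"
proof (cases "(\<integral>\<^sup>+x\<in>A. h x \<partial>M) / ennreal t")
  case top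
  then show ?thesis by (simp add: epowr_top)
next
  case (real j)
  then have I: "(\<integral>\<^sup>+x\<in>A. h x \<partial>M) = ennreal j * ennreal t"
    using t by (simp flip: real(2)) (simp add: ennreal_divide_times mult_divide_eq_ennreal)
  show ?thesis
  \<comment> \<open>The power need not have a finite slope at 0, so this case is separate: there
    \<open>h\<close> vanishes almost everywhere on \<open>A\<close>.\<close>
  proof (cases "j = 0")
    case True
    with I have "(\<integral>\<^sup>+x\<in>A. h x \<partial>M) = 0" by simp
    then have "AE x in M. h x * indicator A x = 0"
      by (subst (asm) nn_integral_0_iff_AE) auto
    then have "AE x in M. epowr (h x) q * indicator A x = 0"
      by eventually_elim (use q in \<open>auto simp: epowr_def\<close>)
    then have "(\<integral>\<^sup>+x\<in>A. epowr (h x) q \<partial>M) = 0"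
      by (subst nn_integral_0_iff_AE) auto
    then show ?thesis by simp
  next
    case False
    with real have j: "0 < j" by simp
    define K1 K2 where "K1 = q * j powr (q - 1)" and "K2 = (1 - q) * j powr q"
    have K: "0 < K1" "0 \<le> K2" using j q by (auto simp: K1_def K2_def)
    \<comment> \<open>The graph of \<open>z \<mapsto> z powr q\<close> lies below its tangent at \<open>j\<close>.\<close>
    have tangent: "epowr z q \<le> ennreal K1 * z + ennreal K2" for z
    proof (cases z)
      case top
      then show ?thesis using K by (simp add: ennreal_mult_top)
    next
      case (real a)
      have "a powr q \<le> K1 * a + K2"
      proof (cases "a = 0")
        case True
        then show ?thesis using K q by simp
      next
        case False
        \<comment> \<open>Weighted arithmetic-geometric mean inequality; multiplying it by
          \<open>j powr (q - 1)\<close> yields the tangent bound.\<close>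
        then have "a powr q * j powr (1 - q) \<le> q * a + (1 - q) * j"
          using real j q by (intro Youngs_inequality_0) auto
        then have "a powr q * j powr (1 - q) * j powr (q - 1) \<le> (q * a + (1 - q) * j) * j powr (q - 1)"
          by (rule mult_right_mono) simp
        moreover have "a powr q * j powr (1 - q) * j powr (q - 1) = a powr q"
          using j by (simp add: mult.assoc flip: powr_add)
        moreover have "(q * a + (1 - q) * j) * j powr (q - 1) = K1 * a + K2"
        proof -
          have "j powr q = j * j powr (q - 1)" using j by (simp add: powr_mult_base)
          then show ?thesis by (simp only: K1_def K2_def) (simp add: algebra_simps)
        qed
        ultimately show ?thesis by simp
      qed
      with real K show ?thesis
        by (simp add: epowr_ennreal flip: ennreal_mult ennreal_plus)
    qed
    have "(\<integral>\<^sup>+x\<in>A. epowr (h x) q \<partial>M)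
        \<le> (\<integral>\<^sup>+x. ennreal K1 * (h x * indicator A x) + ennreal K2 * indicator A x \<partial>M)"
      using tangent by (intro nn_integral_mono) (auto split: split_indicator)
    also have "\<dots> = ennreal K1 * (ennreal j * ennreal t) + ennreal K2 * emeasure M A"
      by (subst nn_integral_add) (auto simp: nn_integral_cmult I)
    \<comment> \<open>The intercept of the tangent is nonnegative, so the mass may be enlarged from
      that of \<open>A\<close> to \<open>t\<close>.\<close>
    also have "\<dots> \<le> ennreal K1 * (ennreal j * ennreal t) + ennreal K2 * ennreal t"
      using t by (intro add_left_mono mult_left_mono) auto
    also have "\<dots> = ennreal ((K1 * j + K2) * t)"
      using j t K by (simp add: algebra_simps flip: ennreal_mult ennreal_plus)
    \<comment> \<open>The tangent touches the graph at \<open>j\<close>.\<close>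
    also have "K1 * j + K2 = j powr q"
      using powr_mult_base[of j "q - 1"] j by (simp add: K1_def K2_def algebra_simps)
    finally have "(\<integral>\<^sup>+x\<in>A. epowr (h x) q \<partial>M) / ennreal t \<le> ennreal (j powr q * t) / ennreal t"
      by (rule divide_right_mono_ennreal)
    also have "\<dots> = ennreal (j powr q)"
      using t by (simp add: divide_ennreal)
    finally show ?thesis using real by (simp add: epowr_ennreal)
  qed
qed

text \<open>As \<open>a - 1\<close> is at most 0, \<open>(u + w) powr (a - 1)\<close> is at most the
  same power of each summand; multiply by that summand and add.\<close>

lemma powr_subadditive:
  fixes u w a :: real
  assumes "0 \<le> u" "0 \<le> w" "0 < a" "a \<le> 1"
  shows "(u + w) powr a \<le> u powr a + w powr a"
proof (cases "u = 0 \<or> w = 0")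
  case False
  then have pos: "0 < u" "0 < w" using assms by auto
  have "z * (u + w) powr (a - 1) \<le> z powr a" if "0 < z" "z \<le> u + w" for z
  proof -
    have "(u + w) powr (a - 1) \<le> z powr (a - 1)"
      using that assms by (intro powr_mono2') auto
    then have "z * (u + w) powr (a - 1) \<le> z * z powr (a - 1)"
      using that by (intro mult_left_mono) auto
    then show ?thesis using that by (simp add: powr_mult_base)
  qed
  from this[of u] this[of w] have "(u + w) * (u + w) powr (a - 1) \<le> u powr a + w powr a"
    using pos by (simp add: algebra_simps)
  then show ?thesis using pos by (simp add: powr_mult_base)
qed (use assms in auto)

text \<open>The triangle inequality for \<open>\<bar>x - y\<bar> powr a\<close>; it explains the
  choice of the exponent \<open>p0 = min 1 p\<close>.\<close>

lemma abs_powr_le: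
  fixes x y a :: real
  assumes "0 < a" "a \<le> 1"
  shows "\<bar>x\<bar> powr a \<le> \<bar>y\<bar> powr a + \<bar>x - y\<bar> powr a"
proof -
  have "\<bar>x\<bar> powr a \<le> (\<bar>y\<bar> + \<bar>x - y\<bar>) powr a"
    using assms by (intro powr_mono2) auto
  also have "\<dots> \<le> \<bar>y\<bar> powr a + \<bar>x - y\<bar> powr a"
    using assms by (intro powr_subadditive) auto
  finally show ?thesis .
qed

section \<open>Finiteness of the rearrangement on \<open>Lp_plus_Linf\<close>\<close>

lemma Lp_plus_Linf_measurable: "f \<in> Lp_plus_Linf M q \<Longrightarrow> f \<in> borel_measurable M"
  by (auto simp: Lp_plus_Linf_def Lp_def Linf_def)

text \<open>Above the level \<open>K powr q + N / t\<close> the bounded part cannot account for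
  \<open>f\<close>, so \<open>\<bar>a x\<bar> powr q\<close> exceeds \<open>N / t\<close> there, and
  Markov's inequality bounds the measure of that set.\<close>

lemma rearr_finite:
  assumes f: "f \<in> Lp_plus_Linf M q" and q: "0 < q" "q \<le> 1" and t: "0 < t"
  shows "rearr M (\<lambda>x. ennreal (\<bar>f x\<bar> powr q)) t \<noteq> \<infinity>"
proof -
  from f obtain a b K where fab: "f = (\<lambda>x. a x + b x)"
    and [measurable]: "a \<in> borel_measurable M" "b \<in> borel_measurable M"
    and a: "integrable M (\<lambda>x. \<bar>a x\<bar> powr q)" and b: "AE x in M. \<bar>b x\<bar> \<le> K"
    by (auto simp: Lp_plus_Linf_def Lp_def Linf_def)
  \<comment> \<open>The added 1 keeps \<open>N\<close> positive even if \<open>a\<close> vanishes;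
    Markov's inequality then gives the measure bound \<open>t * (N - 1) / N\<close>, which is below
    \<open>t\<close>.\<close>
  define N where "N = (\<integral>x. \<bar>a x\<bar> powr q \<partial>M) + 1"
  have N: "0 < N" by (auto simp: N_def intro!: add_nonneg_pos)
  define d where "d = K powr q + N / t"
  have "emeasure M {x \<in> space M. ennreal d < ennreal (\<bar>f x\<bar> powr q)}
      \<le> emeasure M {x \<in> space M. 1 \<le> ennreal (t / N) * ennreal (\<bar>a x\<bar> powr q)}"
  proof (rule emeasure_mono_AE)
    show "AE x in M. x \<in> {x \<in> space M. ennreal d < ennreal (\<bar>f x\<bar> powr q)} \<longrightarrow>
        x \<in> {x \<in> space M. 1 \<le> ennreal (t / N) * ennreal (\<bar>a x\<bar> powr q)}"
      using b
    proof eventually_elim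
      case (elim x)
      have "\<bar>f x\<bar> powr q \<le> \<bar>b x\<bar> powr q + \<bar>a x\<bar> powr q"
        using abs_powr_le[OF q, of "f x" "b x"] by (simp add: fab)
      moreover have "\<bar>b x\<bar> powr q \<le> K powr q"
        using elim q by (intro powr_mono2) auto
      ultimately have "N / t < \<bar>a x\<bar> powr q" if "d < \<bar>f x\<bar> powr q"
        using that by (simp add: d_def)
      then have "1 \<le> t / N * \<bar>a x\<bar> powr q" if "d < \<bar>f x\<bar> powr q"
        using that N t by (simp add: field_simps)
      moreover have "0 \<le> d" using N t by (simp add: d_def)
      ultimately show ?case
        using N t by (auto simp: ennreal_less_iff simp flip: ennreal_mult)
    qed
  qed measurable
  also have "\<dots> \<le> ennreal (t / N) * (\<integral>\<^sup>+x\<in>space M. ennreal (\<bar>a x\<bar> powr q) \<partial>M)"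
    using nn_integral_Markov_inequality[of "\<lambda>x. ennreal (\<bar>a x\<bar> powr q)" "space M" M "ennreal (t / N)"] by simp
  also have "(\<integral>\<^sup>+x\<in>space M. ennreal (\<bar>a x\<bar> powr q) \<partial>M) = ennreal (N - 1)"
    using a by (simp add: nn_integral_set_ennreal[symmetric] N_def nn_integral_eq_integral
        cong: nn_integral_cong_simp)
  also have "ennreal (t / N) * ennreal (N - 1) \<le> ennreal t"
    using N t by (subst ennreal_mult'[symmetric]) (auto intro!: ennreal_leI simp: field_simps)
  finally have "rearr M (\<lambda>x. ennreal (\<bar>f x\<bar> powr q)) t \<le> ennreal d"
    unfolding rearr_def by (intro Inf_lower) simp
  then show ?thesis by (auto simp: top_unique)
qed

section \<open>Growth and inversion of functions in \<open>class_A0\<close>\<close>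

text \<open>Reverse doubling from the positive lower index: for small \<open>c\<close> the dilation
  function is below \<open>c powr (\<beta> / 2)\<close>, hence below 1/2 once \<open>c\<close> is
  small enough, and \<open>K = 1 / c\<close> works.\<close>

lemma class_A0_doubling:
  assumes "v \<in> class_A0"
  obtains K where "0 < K" "\<And>s. 0 < s \<Longrightarrow> 2 * v s \<le> v (K * s)"
proof -
  from assms obtain \<beta> where \<beta>: "0 < \<beta>"
    and lim: "((\<lambda>c. ln (dilation v c) / ln c) \<longlongrightarrow> \<beta>) (at_right 0)"
    and pos: "\<And>s. 0 < s \<Longrightarrow> 0 < v s"
    and bdd: "\<And>c. 0 < c \<Longrightarrow> bdd_above ((\<lambda>s. v (c * s) / v s) ` {0<..})"
    by (auto simp: class_A0_def)
  have "\<forall>\<^sub>F c in at_right 0. \<beta> / 2 < ln (dilation v c) / ln c"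
    using lim \<beta> by (intro order_tendstoD) auto
  \<comment> \<open>The threshold is chosen so that
    \<open>\<beta> / 2 * ln c < ln (1 / 2)\<close>.\<close>
  moreover have "\<forall>\<^sub>F c in at_right (0::real). ln c < - (2 * ln 2 / \<beta>)"
    using ln_at_0 by (simp add: filterlim_at_bot_dense)
  moreover have "\<forall>\<^sub>F c in at_right (0::real). 0 < c"
    by (simp add: eventually_at_right_less)
  ultimately have "\<forall>\<^sub>F c in at_right (0::real). \<beta> / 2 < ln (dilation v c) / ln c
      \<and> ln c < - (2 * ln 2 / \<beta>) \<and> 0 < c"
    by eventually_elim auto
  then obtain c where c: "\<beta> / 2 < ln (dilation v c) / ln c" "ln c < - (2 * ln 2 / \<beta>)" "0 < c"
    using eventually_happens[of _ "at_right (0::real)"] by (auto simp: trivial_limit_at_right_real)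
  have ratio: "v (c * s) / v s \<le> dilation v c" if "0 < s" for s
    unfolding dilation_def using that c by (intro cSUP_upper bdd) auto
  \<comment> \<open>Positivity allows passing from the logarithm of the dilation function back to
    its value.\<close>
  have dil: "0 < dilation v c"
    using ratio[of 1] pos[of c] pos[of 1] c by (smt (verit) divide_pos_pos mult_1_right)
  have "0 < 2 * ln 2 / \<beta>" using \<beta> by simp
  with c(2) have "ln c < 0" by linarith
  with c(1) have "ln (dilation v c) < \<beta> / 2 * ln c"
    by (simp add: neg_less_divide_eq)
  also have "\<dots> < \<beta> / 2 * - (2 * ln 2 / \<beta>)"
    using c(2) \<beta> by (intro mult_strict_left_mono) auto
  also have "\<dots> = ln (1 / 2)" using \<beta> by (simp add: ln_div)
  finally have half: "dilation v c < 1 / 2" using dil by simp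
  show ?thesis
  proof (rule that[of "1 / c"])
    fix s :: real assume s: "0 < s"
    have "v (c * (s / c)) / v (s / c) \<le> 1 / 2"
      using half s c by (intro order_trans[OF ratio]) auto
    then show "2 * v s \<le> v (1 / c * s)"
      using pos[of "s / c"] s c by (simp add: field_simps)
  qed (use c in simp)
qed

text \<open>Iterated reverse doubling makes \<open>v\<close> unbounded along the powers of
  \<open>K\<close>; the intermediate value theorem then supplies a preimage, and strict monotonicity
  makes it unique.\<close>

lemma class_A0_inverse:
  assumes v: "v \<in> class_A0" "strict_mono_on {0..} v" and y: "0 < y"
  shows "0 < inv0 v y" "v (inv0 v y) = y"
proof -
  obtain K where K: "0 < K" "\<And>s. 0 < s \<Longrightarrow> 2 * v s \<le> v (K * s)"
    using class_A0_doubling[OF v(1)] by blast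
  have pow: "2 ^ n * v 1 \<le> v (K ^ n)" for n
  proof (induction n)
    case (Suc n)
    have "2 * (2 ^ n * v 1) \<le> 2 * v (K ^ n)" using Suc by simp
    also have "\<dots> \<le> v (K * K ^ n)" using K by simp
    finally show ?case by simp
  qed simp
  from v(1) have v1: "0 < v 1" and v0: "v 0 = 0" and cont: "continuous_on {0..} v"
    by (auto simp: class_A0_def)
  obtain n where "y / v 1 < 2 ^ n" using real_arch_pow[of 2 "y / v 1"] by auto
  then have "y \<le> v (K ^ n)" using v1 pow[of n] by (simp add: field_simps)
  moreover have "continuous_on {0..K ^ n} v"
    using cont by (rule continuous_on_subset) auto
  ultimately obtain s where s: "0 \<le> s" "v s = y"
    using IVT'[of v 0 y "K ^ n"] K(1) v0 y by auto
  have "inv0 v (v s) = s"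
    unfolding inv0_def using s strict_mono_on_imp_inj_on[OF v(2)] by (intro the_inv_into_f_f) auto
  moreover have "0 < s" using s v0 y by (cases "s = 0") auto
  ultimately show "0 < inv0 v y" "v (inv0 v y) = y" using s by auto
qed

text \<open>Reverse doubling of \<open>v\<close> becomes doubling of its inverse: doubling
  \<open>t\<close> multiplies \<open>inv0 v t\<close> by at most \<open>k\<close>. The effect on
  \<open>\<phi>\<close> is controlled by its dilation function at \<open>k\<close>.\<close>

lemma inverse_doubling:
  assumes v: "v \<in> class_A0" "strict_mono_on {0..} v" and \<phi>: "\<phi> \<in> class_A0"
  obtains K where "0 < K" "\<And>t. 0 < t \<Longrightarrow> \<phi> (inv0 v (2 * t)) \<le> K * \<phi> (inv0 v t)"
proof -
  obtain k where k: "0 < k" "\<And>s. 0 < s \<Longrightarrow> 2 * v s \<le> v (k * s)"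
    using class_A0_doubling[OF v(1)] by blast
  from \<phi> have mono: "mono_on {0..} \<phi>" and pos: "\<And>s. 0 < s \<Longrightarrow> 0 < \<phi> s"
    and bdd: "\<And>c. 0 < c \<Longrightarrow> bdd_above ((\<lambda>s. \<phi> (c * s) / \<phi> s) ` {0<..})"
    by (auto simp: class_A0_def)
  have ratio: "\<phi> (k * s) / \<phi> s \<le> dilation \<phi> k" if "0 < s" for s
    unfolding dilation_def using that k by (intro cSUP_upper bdd) auto
  show ?thesis
  proof (rule that)
    show "0 < dilation \<phi> k"
      using ratio[of 1] pos[of k] pos[of 1] k by (smt (verit) divide_pos_pos mult_1_right)
    fix t :: real assume t: "0 < t"
    define s where "s = inv0 v t"
    have s: "0 < s" "v s = t" using class_A0_inverse[OF v t] by (auto simp: s_def)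
    have r: "0 < inv0 v (2 * t)" "v (inv0 v (2 * t)) = 2 * t"
      using class_A0_inverse[OF v, of "2 * t"] t by auto
    have "inv0 v (2 * t) \<le> k * s"
    proof (rule ccontr)
      assume "\<not> inv0 v (2 * t) \<le> k * s"
      then have "v (k * s) < v (inv0 v (2 * t))"
        using s k r by (intro strict_mono_onD[OF v(2)]) auto
      then show False using k(2)[OF s(1)] s r by simp
    qed
    then have "\<phi> (inv0 v (2 * t)) \<le> \<phi> (k * s)"
      using r s k by (intro mono_onD[OF mono]) auto
    also have "\<dots> \<le> dilation \<phi> k * \<phi> s"
      using ratio[OF s(1)] pos[OF s(1)] by (simp add: field_simps)
    finally show "\<phi> (inv0 v (2 * t)) \<le> dilation \<phi> k * \<phi> (inv0 v t)"
      by (simp add: s_def)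
  qed
qed

section \<open>Balls and averaged moduli in a metric measure space\<close>

locale metric_measure =
  fixes M :: "'a::{metric_space, second_countable_topology} measure"
  assumes mms: "metric_measure_space M"
begin

lemma sets_M [measurable_cong]: "sets M = sets borel"
  using mms by (simp add: metric_measure_space_def)

lemma space_M: "space M = UNIV"
  using sets_eq_imp_space_eq[OF sets_M] by simp

lemma emeasure_ball: "0 < r \<Longrightarrow> 0 < emeasure M (ball x r)" "0 < r \<Longrightarrow> emeasure M (ball x r) < \<infinity>"
  using mms by (auto simp: metric_measure_space_def)

text \<open>Unit balls centred at a countable dense set cover the space and have finite
  measure.\<close>

lemma sigma_finite: "sigma_finite_measure M"
proof
  obtain D :: "'a set" where D: "countable D" "\<And>X. open X \<Longrightarrow> X \<noteq> {} \<Longrightarrow> \<exists>d\<in>D. d \<in> X"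
    using countable_dense_setE by blast
  have "\<exists>d\<in>D. x \<in> ball d 1" for x
    using D(2)[of "ball x 1"] by (auto simp: dist_commute)
  then show "\<exists>A. countable A \<and> A \<subseteq> sets M \<and> \<Union> A = space M \<and> (\<forall>a\<in>A. emeasure M a \<noteq> \<infinity>)"
    using D(1) emeasure_ball(2)[of 1]
    by (intro exI[of _ "(\<lambda>d. ball d 1) ` D"]) (auto simp: space_M sets_M less_top[symmetric])
qed

text \<open>The ball is a section of the measurable set of pairs at distance below \<open>r\<close>,
  so measurability of section integrals applies.\<close>

lemma measurable_nn_integral_ball:
  assumes [measurable]: "case_prod h \<in> borel_measurable (M \<Otimes>\<^sub>M M)"
  shows "(\<lambda>x. \<integral>\<^sup>+y\<in>ball x r. h x y \<partial>M) \<in> borel_measurable M"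
proof -
  interpret sigma_finite_measure M by (rule sigma_finite)
  define B where "B = {z \<in> space (M \<Otimes>\<^sub>M M). dist (fst z) (snd z) < r}"
  have [measurable]: "B \<in> sets (M \<Otimes>\<^sub>M M)"
    unfolding B_def by measurable
  have "(\<integral>\<^sup>+y\<in>ball x r. h x y \<partial>M) = (\<integral>\<^sup>+y. h x y * indicator B (x, y) \<partial>M)" for x
    by (intro nn_integral_cong) (auto simp: B_def space_pair_measure space_M split: split_indicator)
  then show ?thesis by simp
qed

lemma measurable_emeasure_ball: "(\<lambda>x. emeasure M (ball x r)) \<in> borel_measurable M"
  using measurable_nn_integral_ball[of "\<lambda>x y. 1" r] by (simp add: sets_M)

lemma epowr_avg_modulus:
  assumes "0 < p"
  shows "epowr (avg_modulus M p r f x) p =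
    (\<integral>\<^sup>+y\<in>ball x r. ennreal (\<bar>f x - f y\<bar> powr p) \<partial>M) / emeasure M (ball x r)"
  using assms by (simp add: avg_modulus_def epowr_epowr epowr_one)

lemma measurable_avg_modulus:
  assumes [measurable]: "f \<in> borel_measurable M"
  shows "avg_modulus M p r f \<in> borel_measurable M"
proof -
  note [measurable] = measurable_emeasure_ball
  have [measurable]: "(\<lambda>x. \<integral>\<^sup>+y\<in>ball x r. ennreal (\<bar>f x - f y\<bar> powr p) \<partial>M) \<in> borel_measurable M"
    by (rule measurable_nn_integral_ball) measurable
  show ?thesis unfolding avg_modulus_def by measurable
qed

text \<open>\<open>A\<close> fills at most half of the ball, and on the remaining part the integrand
  is at least \<open>w\<close>; the factor 2 compensates for the discarded half.\<close>

lemma avg_modulus_ge: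
  assumes [measurable]: "A \<in> sets M" "f \<in> borel_measurable M" and p: "0 < p" and r: "0 < r"
    and A: "2 * emeasure M A \<le> emeasure M (ball x r)"
    and w: "\<And>y. y \<notin> A \<Longrightarrow> w \<le> ennreal (\<bar>f x - f y\<bar> powr p)"
  shows "w \<le> 2 * epowr (avg_modulus M p r f x) p"
proof -
  let ?B = "ball x r"
  let ?I = "\<integral>\<^sup>+y\<in>?B. ennreal (\<bar>f x - f y\<bar> powr p) \<partial>M"
  have [measurable]: "?B \<in> sets M" by (simp add: sets_M)
  have "emeasure M ?B \<le> emeasure M (?B - A) + emeasure M A"
    by (rule order_trans[OF emeasure_mono emeasure_subadditive]) auto
  then have "2 * emeasure M ?B \<le> 2 * (emeasure M (?B - A) + emeasure M A)"
    by (intro mult_left_mono) auto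
  also have "\<dots> \<le> 2 * emeasure M (?B - A) + emeasure M ?B"
    using A by (simp add: distrib_left)
  \<comment> \<open>One copy of \<open>emeasure M ?B\<close> is cancelled, which is allowed because
    balls have finite measure.\<close>
  finally have half: "emeasure M ?B \<le> 2 * emeasure M (?B - A)"
    using emeasure_ball(2)[OF r, of x]
      ennreal_add_left_cancel_le[of "emeasure M ?B" "emeasure M ?B" "2 * emeasure M (?B - A)"]
    by (auto simp: mult_2[of "emeasure M ?B"] add.commute[of "2 * emeasure M (?B - A)"])
  have "w * emeasure M ?B \<le> w * (2 * emeasure M (?B - A))"
    using half by (rule mult_left_mono) simp
  also have "\<dots> = 2 * (\<integral>\<^sup>+y. w * indicator (?B - A) y \<partial>M)"
    by (simp add: nn_integral_cmult mult_ac)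
  also have "\<dots> \<le> 2 * ?I"
    by (intro mult_left_mono nn_integral_mono) (auto split: split_indicator intro: w)
  finally have "w * emeasure M ?B / emeasure M ?B \<le> 2 * ?I / emeasure M ?B"
    by (rule divide_right_mono_ennreal)
  then show ?thesis
    using emeasure_ball[OF r, of x] p
    by (simp add: ennreal_mult_divide_eq epowr_avg_modulus ennreal_times_divide)
qed

section \<open>Oscillation estimates at a fixed radius\<close>

text \<open>The integral over \<open>A\<close> is kept instead of a maximal rearrangement, so that
  the gradient estimate can be inserted before anything is rearranged.\<close>

lemma osc_le:
  assumes f: "f \<in> Lp_plus_Linf M p0" and p: "0 < p" "p0 = min 1 p" and t: "0 < t" and r: "0 < r"
    and B: "\<And>x. ennreal (2 * t) \<le> emeasure M (ball x r)"
  obtains A where "A \<in> sets M" "emeasure M A \<le> ennreal t"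
    "osc M (\<lambda>x. ennreal (\<bar>f x\<bar> powr p0)) t \<le>
      epowr (2 * ((\<integral>\<^sup>+x\<in>A. epowr (avg_modulus M p r f x) p \<partial>M) / ennreal t)) (p0 / p)"
proof -
  have p0: "0 < p0" "p0 \<le> 1" "0 < p0 / p" "p0 / p \<le> 1" using p by auto
  note [measurable] = Lp_plus_Linf_measurable[OF f]
  let ?F = "\<lambda>x. ennreal (\<bar>f x\<bar> powr p0)"
  let ?G = "\<lambda>x. epowr (avg_modulus M p r f x) p"
  have G [measurable]: "?G \<in> borel_measurable M"
    using measurable_avg_modulus by measurable
  define A where "A = {x \<in> space M. rearr M ?F t < ?F x}"
  have A_sets [measurable]: "A \<in> sets M" unfolding A_def by measurable
  have A_le: "emeasure M A \<le> ennreal t"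
    using rearr_less_iff[of ?F M "rearr M ?F t" t] by (auto simp: A_def not_less)
  have fin: "rearr M ?F t \<noteq> \<infinity>" using rearr_finite[OF f p0(1,2) t] .
  then obtain c where c: "0 \<le> c" "rearr M ?F t = ennreal c"
    by (cases "rearr M ?F t") auto
  have pt: "?F x - rearr M ?F t \<le> epowr (2 * ?G x) (p0 / p) * indicator A x" for x
  proof (cases "x \<in> A")
    case False
    then show ?thesis by (simp add: A_def space_M not_less diff_eq_0_iff_ennreal)
  next
    case True
    then have gt: "c < \<bar>f x\<bar> powr p0" using c by (simp add: A_def ennreal_less_iff)
    define z where "z = \<bar>f x\<bar> powr p0 - c"
    have "ennreal (z powr (p / p0)) \<le> 2 * ?G x"
    proof (rule avg_modulus_ge[OF A_sets _ p(1) r])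
      have "2 * emeasure M A \<le> 2 * ennreal t" using A_le by (intro mult_left_mono) auto
      also have "\<dots> = ennreal (2 * t)" using t by (simp add: ennreal_mult)
      also note B[of x]
      finally show "2 * emeasure M A \<le> emeasure M (ball x r)" .
    next
      fix y assume "y \<notin> A"
      then have "\<bar>f y\<bar> powr p0 \<le> c" using c by (simp add: A_def space_M not_less)
      then have "z \<le> \<bar>f x - f y\<bar> powr p0"
        using abs_powr_le[OF p0(1,2), of "f x" "f y"] by (simp add: z_def)
      \<comment> \<open>The exponent \<open>p / p0\<close> turns the bound into one by
        \<open>\<bar>f x - f y\<bar> powr p\<close>, the integrand of the averaged modulus.\<close>
      then have "z powr (p / p0) \<le> (\<bar>f x - f y\<bar> powr p0) powr (p / p0)"
        using gt p p0 by (intro powr_mono2) (auto simp: z_def)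
      then show "ennreal (z powr (p / p0)) \<le> ennreal (\<bar>f x - f y\<bar> powr p)"
        using p0 by (simp add: powr_powr ennreal_leI)
    qed measurable
    then have "epowr (ennreal (z powr (p / p0))) (p0 / p) \<le> epowr (2 * ?G x) (p0 / p)"
      using p0 by (intro epowr_mono) auto
    moreover have "epowr (ennreal (z powr (p / p0))) (p0 / p) = ennreal z"
      using gt p p0 by (simp add: epowr_ennreal powr_powr z_def)
    moreover have "?F x - rearr M ?F t = ennreal z"
      using c by (simp add: z_def ennreal_minus)
    ultimately show ?thesis using True by simp
  qed
  have "osc M ?F t = (\<integral>\<^sup>+x. ?F x - rearr M ?F t \<partial>M) / ennreal t"
    using fin t by (intro osc_eq sigma_finite) auto
  also have "\<dots> \<le> (\<integral>\<^sup>+x\<in>A. epowr (2 * ?G x) (p0 / p) \<partial>M) / ennreal t"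
    by (intro divide_right_mono_ennreal nn_integral_mono pt)
  \<comment> \<open>Jensen's inequality, available since \<open>p0 / p\<close> is at most 1.\<close>
  also have "\<dots> \<le> epowr ((\<integral>\<^sup>+x\<in>A. 2 * ?G x \<partial>M) / ennreal t) (p0 / p)"
    using A_le t p0 by (intro nn_integral_epowr_le) auto
  also have "(\<integral>\<^sup>+x\<in>A. 2 * ?G x \<partial>M) / ennreal t = 2 * ((\<integral>\<^sup>+x\<in>A. ?G x \<partial>M) / ennreal t)"
    by (simp add: nn_integral_cmult mult.assoc ennreal_times_divide)
  finally show ?thesis by (rule that[OF A_sets A_le])
qed

text \<open>Inside the ball \<open>\<phi> (dist x y)\<close> is at most \<open>\<phi> r\<close>.
  Averaging in \<open>y\<close> leaves the term at \<open>x\<close> and turns the other one into a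
  ball average, bounded by the maximal rearrangement because the ball has measure at least
  \<open>t\<close>.\<close>

lemma avg_modulus_hajlasz:
  assumes g: "g \<in> hajlasz_gradients M \<phi> f" and \<phi>: "mono_on {0..} \<phi>" and phi_r: "0 \<le> \<phi> r" and p: "0 < p"
    and r: "0 < r" and t: "0 < t" and B: "\<And>x. ennreal t \<le> emeasure M (ball x r)"
  shows "AE x in M. epowr (avg_modulus M p r f x) p \<le>
    ennreal ((2 * \<phi> r) powr p) * (epowr (g x) p + rearr_avg M (\<lambda>x. epowr (g x) p) t)"
proof -
  from g have [measurable]: "g \<in> borel_measurable M"
    and ae: "AE x in M. AE y in M. ennreal \<bar>f x - f y\<bar> \<le> ennreal (\<phi> (dist x y)) * (g x + g y)"
    unfolding hajlasz_gradients_def by blast+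
  let ?H = "\<lambda>x. epowr (g x) p"
  define k where "k = ennreal ((2 * \<phi> r) powr p)"
  \<comment> \<open>The iterated exceptional sets fit the argument: a good \<open>x\<close> is fixed
    first, and only then is the inequality integrated over almost every \<open>y\<close>.\<close>
  show ?thesis
    using ae unfolding k_def[symmetric]
  proof eventually_elim
    case (elim x)
    let ?B = "ball x r"
    have [measurable]: "?B \<in> sets M" by (simp add: sets_M)
    have "AE y in M. ennreal (\<bar>f x - f y\<bar> powr p) * indicator ?B y
        \<le> k * (?H x * indicator ?B y + ?H y * indicator ?B y)"
      using elim
    proof eventually_elim
      case (elim y)
      show ?case
      proof (cases "y \<in> ?B")
        case True
        have "\<phi> (dist x y) \<le> \<phi> r"
          using True r by (intro mono_onD[OF \<phi>]) auto
        then have "ennreal \<bar>f x - f y\<bar> \<le> ennreal (\<phi> r) * (g x + g y)"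
          using elim by (meson ennreal_leI mult_right_mono order_trans zero_le)
        then have "epowr (ennreal \<bar>f x - f y\<bar>) p \<le> epowr (ennreal (\<phi> r) * (g x + g y)) p"
          using p by (rule epowr_mono)
        also have "\<dots> = ennreal (\<phi> r powr p) * epowr (g x + g y) p"
          using p phi_r by (simp add: epowr_mult epowr_ennreal)
        also have "\<dots> \<le> ennreal (\<phi> r powr p) * (ennreal (2 powr p) * (?H x + ?H y))"
          using p by (intro mult_left_mono epowr_add_le) auto
        also have "\<dots> = k * (?H x + ?H y)"
          using phi_r by (simp add: k_def powr_mult ennreal_mult mult_ac)
        finally show ?thesis using True by (simp add: epowr_ennreal)
      qed simp
    qed
    then have "(\<integral>\<^sup>+y\<in>?B. ennreal (\<bar>f x - f y\<bar> powr p) \<partial>M)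
        \<le> (\<integral>\<^sup>+y. k * (?H x * indicator ?B y + ?H y * indicator ?B y) \<partial>M)"
      by (rule nn_integral_mono_AE)
    also have "\<dots> = k * (?H x * emeasure M ?B + (\<integral>\<^sup>+y\<in>?B. ?H y \<partial>M))"
      by (simp add: nn_integral_cmult nn_integral_add)
    finally have "epowr (avg_modulus M p r f x) p
        \<le> k * (?H x * emeasure M ?B + (\<integral>\<^sup>+y\<in>?B. ?H y \<partial>M)) / emeasure M ?B"
      using p by (simp add: epowr_avg_modulus divide_right_mono_ennreal)
    also have "\<dots> = k * (?H x + (\<integral>\<^sup>+y\<in>?B. ?H y \<partial>M) / emeasure M ?B)"
      using emeasure_ball[OF r, of x]
      by (simp add: ennreal_times_divide[symmetric] add_divide_distrib_ennreal ennreal_mult_divide_eq)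
    also have "\<dots> \<le> k * (?H x + rearr_avg M ?H t)"
      using t B emeasure_ball(2)[OF r, of x]
      by (intro mult_left_mono add_left_mono nn_average_le_rearr_avg sigma_finite) auto
    finally show ?case .
  qed
qed

lemma osc_le_avg_modulus:
  assumes f: "f \<in> Lp_plus_Linf M p0" and p: "0 < p" "p0 = min 1 p" and t: "0 < t" and r: "0 < r"
    and B: "\<And>x. ennreal (2 * t) \<le> emeasure M (ball x r)"
  shows "osc M (\<lambda>x. ennreal (\<bar>f x\<bar> powr p0)) t \<le>
    epowr (2 * rearr_avg M (\<lambda>x. epowr (avg_modulus M p r f x) p) t) (p0 / p)"
proof -
  obtain A where A: "A \<in> sets M" "emeasure M A \<le> ennreal t"
    and le: "osc M (\<lambda>x. ennreal (\<bar>f x\<bar> powr p0)) t \<le>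
      epowr (2 * ((\<integral>\<^sup>+x\<in>A. epowr (avg_modulus M p r f x) p \<partial>M) / ennreal t)) (p0 / p)"
    using osc_le[OF assms] by blast
  note le
  also have "epowr (2 * ((\<integral>\<^sup>+x\<in>A. epowr (avg_modulus M p r f x) p \<partial>M) / ennreal t)) (p0 / p)
      \<le> epowr (2 * rearr_avg M (\<lambda>x. epowr (avg_modulus M p r f x) p) t) (p0 / p)"
    using A p t measurable_avg_modulus[OF Lp_plus_Linf_measurable[OF f]]
    by (intro epowr_mono mult_left_mono nn_integral_le_rearr_avg sigma_finite measurable_epowr) auto
  finally show ?thesis .
qed

lemma osc_le_hajlasz:
  assumes f: "f \<in> Lp_plus_Linf M p0" and g: "g \<in> hajlasz_gradients M \<phi> f"
    and \<phi>: "mono_on {0..} \<phi>" and phi_r: "0 \<le> \<phi> r"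
    and p: "0 < p" "p0 = min 1 p" and t: "0 < t" and r: "0 < r"
    and B: "\<And>x. ennreal (2 * t) \<le> emeasure M (ball x r)"
  shows "osc M (\<lambda>x. ennreal (\<bar>f x\<bar> powr p0)) t \<le>
    epowr (ennreal (4 * (2 * \<phi> r) powr p) * rearr_avg M (\<lambda>x. epowr (g x) p) t) (p0 / p)"
proof -
  from g have [measurable]: "g \<in> borel_measurable M" by (simp add: hajlasz_gradients_def)
  let ?H = "\<lambda>x. epowr (g x) p"
  let ?R = "rearr_avg M ?H t"
  define k where "k = ennreal ((2 * \<phi> r) powr p)"
  obtain A where A [measurable]: "A \<in> sets M" and A_le: "emeasure M A \<le> ennreal t"
    and le: "osc M (\<lambda>x. ennreal (\<bar>f x\<bar> powr p0)) t \<le>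
      epowr (2 * ((\<integral>\<^sup>+x\<in>A. epowr (avg_modulus M p r f x) p \<partial>M) / ennreal t)) (p0 / p)"
    using osc_le[OF f p t r B] by blast
  have "ennreal t \<le> emeasure M (ball x r)" for x
    by (rule order_trans[OF _ B]) (use t in \<open>simp add: ennreal_leI\<close>)
  then have ae: "AE x in M. epowr (avg_modulus M p r f x) p \<le> k * (?H x + ?R)"
    unfolding k_def using g \<phi> phi_r p(1) r t by (intro avg_modulus_hajlasz) auto
  have "(\<integral>\<^sup>+x\<in>A. epowr (avg_modulus M p r f x) p \<partial>M)
      \<le> (\<integral>\<^sup>+x. k * (?H x * indicator A x + ?R * indicator A x) \<partial>M)"
    using ae by (intro nn_integral_mono_AE) (auto split: split_indicator)
  also have "\<dots> = k * ((\<integral>\<^sup>+x\<in>A. ?H x \<partial>M) + ?R * emeasure M A)"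
    by (simp add: nn_integral_cmult nn_integral_add)
  also have "\<dots> \<le> k * ((\<integral>\<^sup>+x\<in>A. ?H x \<partial>M) + ?R * ennreal t)"
    using A_le by (intro mult_left_mono add_left_mono) auto
  finally have "(\<integral>\<^sup>+x\<in>A. epowr (avg_modulus M p r f x) p \<partial>M) / ennreal t
      \<le> k * ((\<integral>\<^sup>+x\<in>A. ?H x \<partial>M) + ?R * ennreal t) / ennreal t"
    by (rule divide_right_mono_ennreal)
  also have "\<dots> = k * ((\<integral>\<^sup>+x\<in>A. ?H x \<partial>M) / ennreal t + ?R)"
    using t by (simp add: ennreal_times_divide[symmetric] add_divide_distrib_ennreal ennreal_mult_divide_eq)
  \<comment> \<open>The integral of \<open>?H\<close> over \<open>A\<close> also costs at most one
    \<open>?R\<close>. These two copies and the factor 2 from \<open>osc_le\<close> produce the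
    constant 4.\<close>
  also have "\<dots> \<le> k * (?R + ?R)"
    using t A_le by (intro mult_left_mono add_right_mono nn_integral_le_rearr_avg sigma_finite) auto
  finally have "2 * ((\<integral>\<^sup>+x\<in>A. epowr (avg_modulus M p r f x) p \<partial>M) / ennreal t) \<le> 2 * (k * (?R + ?R))"
    by (rule mult_left_mono) simp
  also have "\<dots> = ennreal (4 * (2 * \<phi> r) powr p) * ?R"
    by (simp add: k_def ennreal_mult mult_2[symmetric] mult_ac)
  finally show ?thesis
    using p by (intro order_trans[OF le] epowr_mono) auto
qed

end

section \<open>Choice of the radius and of the constants\<close>

theorem theorem3:
  fixes M :: "'a::{metric_space, second_countable_topology} measure"
    and v :: "real \<Rightarrow> real" and p p0 :: real
  assumes "metric_measure_space M"
    and "v \<in> class_A0" and "strict_mono_on {0..} v"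
    and "\<And>r. 0 < r \<Longrightarrow> ennreal (v r) \<le> h_mu M r"
    and "0 < p" and "p0 = min 1 p"
  shows "(\<exists>C>0. \<forall>f \<in> Lp_plus_Linf M p0. \<forall>t>0.
            epowr (osc M (\<lambda>x. ennreal (\<bar>f x\<bar> powr p0)) t) (1 / p0)
              \<le> ennreal C *
                epowr (rearr_avg M (\<lambda>x. epowr (avg_modulus M p (inv0 v (2 * t)) f x) p) t) (1 / p))
       \<and> (\<forall>\<phi> \<in> class_A0.
            (\<exists>C>0. \<forall>f \<in> Lp_plus_Linf M p0. \<forall>g \<in> hajlasz_gradients M \<phi> f. \<forall>t>0.
               epowr (osc M (\<lambda>x. ennreal (\<bar>f x\<bar> powr p0)) t) (1 / p0)
                 \<le> ennreal C * ennreal (\<phi> (inv0 v t)) *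
                   epowr (rearr_avg M (\<lambda>x. epowr (g x) p) t) (1 / p)) \<and>
            (\<exists>C'>0. \<forall>f \<in> Lp_plus_Linf M p0. \<forall>g \<in> hajlasz_gradients M \<phi> f. \<forall>t>0.
               osc M (\<lambda>x. ennreal (\<bar>f x\<bar> powr p0)) t
                 \<le> ennreal C' * ennreal (\<phi> (inv0 v t) powr p0) *
                   epowr (rearr_avg M (\<lambda>x. epowr (g x) p) t) (p0 / p)))"
proof (intro conjI ballI)
  interpret metric_measure M by standard fact
  note p = assms(5,6)
  have p0: "0 < p0" using p by auto
  have r: "0 < inv0 v (2 * t)" if "0 < t" for t
    using class_A0_inverse(1)[OF assms(2,3), of "2 * t"] that by simp
  \<comment> \<open>The lower bound \<open>v\<close> for \<open>h_mu\<close> enters here: the radius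
    is chosen so that \<open>v\<close> takes the value \<open>2 * t\<close> at it.\<close>
  have B: "ennreal (2 * t) \<le> emeasure M (ball x (inv0 v (2 * t)))" if "0 < t" for t x
  proof -
    have "ennreal (2 * t) = ennreal (v (inv0 v (2 * t)))"
      using class_A0_inverse(2)[OF assms(2,3), of "2 * t"] that by simp
    also have "\<dots> \<le> h_mu M (inv0 v (2 * t))" using r[OF that] by (rule assms(4))
    also have "\<dots> \<le> emeasure M (ball x (inv0 v (2 * t)))" unfolding h_mu_def by (rule INF_lower) simp
    finally show ?thesis .
  qed
  have root: "epowr (osc M (\<lambda>x. ennreal (\<bar>f x\<bar> powr p0)) t) (1 / p0) \<le> epowr z (1 / p)"
    if "osc M (\<lambda>x. ennreal (\<bar>f x\<bar> powr p0)) t \<le> epowr z (p0 / p)" for f t z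
    using epowr_mono[OF that, of "1 / p0"] p0 by (simp add: epowr_epowr)
  show "\<exists>C>0. \<forall>f \<in> Lp_plus_Linf M p0. \<forall>t>0.
      epowr (osc M (\<lambda>x. ennreal (\<bar>f x\<bar> powr p0)) t) (1 / p0)
        \<le> ennreal C *
          epowr (rearr_avg M (\<lambda>x. epowr (avg_modulus M p (inv0 v (2 * t)) f x) p) t) (1 / p)"
  proof (intro exI[of _ "2 powr (1 / p)"] conjI ballI allI impI)
    fix f and t :: real assume f: "f \<in> Lp_plus_Linf M p0" and t: "0 < t"
    show "epowr (osc M (\<lambda>x. ennreal (\<bar>f x\<bar> powr p0)) t) (1 / p0)
        \<le> ennreal (2 powr (1 / p)) *
          epowr (rearr_avg M (\<lambda>x. epowr (avg_modulus M p (inv0 v (2 * t)) f x) p) t) (1 / p)"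
      using root[OF osc_le_avg_modulus[OF f p t r[OF t] B[OF t]]] p(1) epowr_ennreal_mult[of "1 / p" 2]
      by simp
  qed simp
  fix \<phi> :: "real \<Rightarrow> real" assume \<phi>: "\<phi> \<in> class_A0"
  then have mono: "mono_on {0..} \<phi>" and pos: "\<And>s. 0 < s \<Longrightarrow> 0 < \<phi> s"
    by (auto simp: class_A0_def)
  \<comment> \<open>The estimates involve the radius belonging to \<open>2 * t\<close>; doubling
    returns to \<open>inv0 v t\<close> at the price of \<open>K\<close>.\<close>
  obtain K where K: "0 < K" "\<And>t. 0 < t \<Longrightarrow> \<phi> (inv0 v (2 * t)) \<le> K * \<phi> (inv0 v t)"
    using inverse_doubling[OF assms(2,3) \<phi>] by blast
  have bound: "osc M (\<lambda>x. ennreal (\<bar>f x\<bar> powr p0)) t \<le>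
      epowr (ennreal (4 * (2 * K * \<phi> (inv0 v t)) powr p) * rearr_avg M (\<lambda>x. epowr (g x) p) t) (p0 / p)"
    if "f \<in> Lp_plus_Linf M p0" "g \<in> hajlasz_gradients M \<phi> f" "0 < t" for f g t
  proof -
    have phi: "0 \<le> \<phi> (inv0 v (2 * t))" using pos[OF r[OF that(3)]] by simp
    have "osc M (\<lambda>x. ennreal (\<bar>f x\<bar> powr p0)) t \<le>
        epowr (ennreal (4 * (2 * \<phi> (inv0 v (2 * t))) powr p) * rearr_avg M (\<lambda>x. epowr (g x) p) t) (p0 / p)"
      using that phi by (intro osc_le_hajlasz[where \<phi> = \<phi>] mono p r B)
    also have "\<dots> \<le> epowr (ennreal (4 * (2 * K * \<phi> (inv0 v t)) powr p) *
        rearr_avg M (\<lambda>x. epowr (g x) p) t) (p0 / p)"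
      using K(2)[OF that(3)] phi p p0
      by (intro epowr_mono mult_right_mono ennreal_leI mult_left_mono powr_mono2) auto
    finally show ?thesis .
  qed
  have phi_pos: "0 < \<phi> (inv0 v t)" if "0 < t" for t
    using pos class_A0_inverse(1)[OF assms(2,3) that] by simp
  show "\<exists>C>0. \<forall>f \<in> Lp_plus_Linf M p0. \<forall>g \<in> hajlasz_gradients M \<phi> f. \<forall>t>0.
      epowr (osc M (\<lambda>x. ennreal (\<bar>f x\<bar> powr p0)) t) (1 / p0)
        \<le> ennreal C * ennreal (\<phi> (inv0 v t)) *
          epowr (rearr_avg M (\<lambda>x. epowr (g x) p) t) (1 / p)"
  \<comment> \<open>The witness is what remains of the root of order \<open>p\<close> of
    \<open>4 * (2 * K * \<phi> (inv0 v t)) powr p\<close> after \<open>\<phi> (inv0 v t)\<close> is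
    split off.\<close>
  proof (intro exI[of _ "4 powr (1 / p) * (2 * K)"] conjI ballI allI impI)
    fix f g and t :: real
    assume f: "f \<in> Lp_plus_Linf M p0" and g: "g \<in> hajlasz_gradients M \<phi> f" and t: "0 < t"
    have "(4 * (2 * K * \<phi> (inv0 v t)) powr p) powr (1 / p) = 4 powr (1 / p) * (2 * K) * \<phi> (inv0 v t)"
      using p(1) K(1) phi_pos[OF t] by (simp add: powr_mult powr_powr)
    then show "epowr (osc M (\<lambda>x. ennreal (\<bar>f x\<bar> powr p0)) t) (1 / p0)
        \<le> ennreal (4 powr (1 / p) * (2 * K)) * ennreal (\<phi> (inv0 v t)) *
          epowr (rearr_avg M (\<lambda>x. epowr (g x) p) t) (1 / p)"
      using root[OF bound[OF f g t]] p(1) K(1) phi_pos[OF t]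
      by (simp add: epowr_ennreal_mult flip: ennreal_mult)
  qed (use K in simp)
  show "\<exists>C'>0. \<forall>f \<in> Lp_plus_Linf M p0. \<forall>g \<in> hajlasz_gradients M \<phi> f. \<forall>t>0.
      osc M (\<lambda>x. ennreal (\<bar>f x\<bar> powr p0)) t
        \<le> ennreal C' * ennreal (\<phi> (inv0 v t) powr p0) *
          epowr (rearr_avg M (\<lambda>x. epowr (g x) p) t) (p0 / p)"
  \<comment> \<open>The same constant raised to the power \<open>p0\<close>.\<close>
  proof (intro exI[of _ "4 powr (p0 / p) * (2 * K) powr p0"] conjI ballI allI impI)
    fix f g and t :: real
    assume f: "f \<in> Lp_plus_Linf M p0" and g: "g \<in> hajlasz_gradients M \<phi> f" and t: "0 < t"
    have "(4 * (2 * K * \<phi> (inv0 v t)) powr p) powr (p0 / p) =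
        4 powr (p0 / p) * (2 * K) powr p0 * \<phi> (inv0 v t) powr p0"
      using p(1) K(1) phi_pos[OF t] by (simp add: powr_mult powr_powr)
    then show "osc M (\<lambda>x. ennreal (\<bar>f x\<bar> powr p0)) t
        \<le> ennreal (4 powr (p0 / p) * (2 * K) powr p0) * ennreal (\<phi> (inv0 v t) powr p0) *
          epowr (rearr_avg M (\<lambda>x. epowr (g x) p) t) (p0 / p)"
      using bound[OF f g t] p(1) p0 K(1) phi_pos[OF t]
      by (simp add: epowr_ennreal_mult flip: ennreal_mult)
  qed (use K in simp)
qed

end
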